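(* Let $\mathcal{G}$ be an ultragraph and let $R$ be a field. For each equivalence class $[p]$ of elements of $\mathfrak{p}^*\cup\mathfrak{p}^\infty$, the representation $\pi:L_R(\mathcal{G})\rightarrow \mathrm{End}_R(\mathbb{P}_{[p]})$ is irreducible.
   Context: An ultragraph is a quadruple $\mathcal{G}=(G^0,\mathcal{G}^1,r,s)$ where $G^0,\mathcal{G}^1$ are countable sets, $s:\mathcal{G}^1\to G^0$ and $r:\mathcal{G}^1\to P(G^0)\setminus\{\emptyset\}$ are maps. $\mathcal{G}^0$ is the smallest subset of $P(G^0)$ containing $\{v\}$ for all $v\in G^0$ and $r(e)$ for all $e\in\mathcal{G}^1$, and closed under finite unions and non-empty finite intersections. A vertex $v$ is a sink if $s^{-1}(v)=\emptyset$; $G^0_s$ is the set of sinks. $L_R(\mathcal{G})$ is the universal (not necessarily unital) $R$-algebra with generators $\{s_e,s_e^*:e\in\mathcal{G}^1\}\cup\{p_A:A\in\mathcal{G}^0\}$ and relations: (1) $p_\emptyset=0$, $p_Ap_B=p_{A\cap B}$, $p_{A\cup B}=p_A+p_B-p_{A\cap B}$ for all $A,B\in\mathcal{G}^0$; (2) $p_{s(e)}s_e=s_ep_{r(e)}=s_e$ and $p_{r(e)}s_e^*=s_e^*p_{s(e)}=s_e^*$ for each $e$; (3) $s_e^*s_f=\delta_{e,f}p_{r(e)}$ for all $e,f$; (4) $p_v=\sum_{s(e)=v}s_es_e^*$ whenever $0<|s^{-1}(v)|<\infty$ (where $p_v=p_{\{v\}}$). A representation on an $R$-module $M$ is an $R$-algebra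 homomorphism $L_R(\mathcal{G})\to \mathrm{End}_R(M)$; it is irreducible if $M\ne0$ and the only invariant submodules of $M$ are $0$ and $M$. A finite path of length $n\ge1$ is a sequence of edges $\alpha=e_1\dots e_n$ with $s(e_{i+1})\in r(e_i)$ for $1\le i\le n-1$; $s(\alpha)=s(e_1)$, $r(\alpha)=r(e_n)$. An infinite path is a sequence $e_1e_2e_3\dots$ of edges with $s(e_{i+1})\in r(e_i)$ for all $i\ge1$, with source $s(e_1)$. $\mathfrak{p}^\infty$ is the set of infinite paths, and $\mathfrak{p}^*=\{(\alpha,v):\alpha \text{ a finite path of length}\ge1,\ v\in r(\alpha)\cap G^0_s\}\cup\{(v,v):v\in G^0_s\}$, with $s(\alpha,v)=s(\alpha)$ and $s(v,v)=v$. Elements $\alpha,\beta\in\mathfrak{p}^*\cup\mathfrak{p}^\infty$ are equivalent if either $\alpha,\beta\in\mathfrak{p}^\infty$ and there are $i,j\ge0$ with $\alpha_{i+k}=\beta_{j+k}$ for all $k\ge1$, or $\alpha,\beta\in\mathfrak{p}^*$ with $\alpha=(a,v)$, $\beta=(b,v)$ for the same sink $v$. $[\alpha]$ denotes the equivalence class of $\alpha$. $\mathbb{P}$ is the free $R$-module with basis $\{b_\alpha:\alpha\in\mathfrak{p}^*\cup\mathfrak{p}^\infty\}$, and $\mathbb{P}_{[p]}$ is the submodule generated by $\{b_\beta:\beta\in[p]\}$. For a statement $q$, $[q]=1$ if $q$ is true and $0$ otherwise. $\pi:L_R(\mathcal{G})\to \mathrm{End}_R(\mathbb{P})$ is the representation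 with $\pi(p_A)(b_\alpha)=[s(\alpha)\in A]b_\alpha$, $\pi(s_e)(b_\alpha)=[s(\alpha)\in r(e)]b_{e\alpha}$, $\pi(s_e^* )(b_\alpha)=[\alpha_1=e]b_{\alpha_2\alpha_3\dots}$. Here, for $\alpha=(a,v)\in\mathfrak{p}^*$ with $|a|\ge1$, $e\alpha=(ea,v)$, $\alpha_1=a_1$, and $b_{\alpha_2\alpha_3\dots}$ means $b_{(a_2\dots a_{|a|},v)}$ if $|a|\ge2$ and $b_{(v,v)}$ if $|a|=1$; for $\alpha=(v,v)$ with $v\in r(e)$, $e\alpha=(e,v)$; and $\pi(s_e^* )(b_{(v,v)})=0$. Each $\mathbb{P}_{[p]}$ is $\pi$-invariant, and the restriction of $\pi$ to $\mathbb{P}_{[p]}$ is still denoted $\pi:L_R(\mathcal{G})\to \mathrm{End}_R(\mathbb{P}_{[p]})$. *)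

theory Defs
  imports Complex_Main "HOL-Library.Poly_Mapping" "HOL-Library.FuncSet" "HOL-Library.Countable_Set"
begin

section \<open>Not necessarily unital algebras and their representations\<close>

record ('a, 'r) alg =
  alg_carrier :: "'a set"
  alg_add :: "'a \<Rightarrow> 'a \<Rightarrow> 'a"
  alg_mult :: "'a \<Rightarrow> 'a \<Rightarrow> 'a"
  alg_scale :: "'r \<Rightarrow> 'a \<Rightarrow> 'a"

definition alg_hom :: "('a, 'r) alg \<Rightarrow> ('b, 'r) alg \<Rightarrow> ('a \<Rightarrow> 'b) \<Rightarrow> bool" where
  "alg_hom A B f \<longleftrightarrow>
     f \<in> alg_carrier A \<rightarrow> alg_carrier B \<and>
     (\<forall>x\<in>alg_carrier A. \<forall>y\<in>alg_carrier A.
        f (alg_add A x y) = alg_add B (f x) (f y) \<and>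
        f (alg_mult A x y) = alg_mult B (f x) (f y)) \<and>
     (\<forall>c. \<forall>x\<in>alg_carrier A. f (alg_scale A c x) = alg_scale B c (f x))"

text \<open>Submodules \<open>M\<close> of an ambient module with scalar multiplication \<open>sc\<close>. An endomorphism of \<open>M\<close> is
  represented by the unique function that is extensional on \<open>M\<close> (that is, \<open>undefined\<close> outside \<open>M\<close>)
  and agrees with it on \<open>M\<close>.\<close>

definition End_alg :: "('r::comm_ring_1 \<Rightarrow> 'm::ab_group_add \<Rightarrow> 'm) \<Rightarrow> 'm set \<Rightarrow> ('m \<Rightarrow> 'm, 'r) alg" where
  "End_alg sc M = \<lparr>
     alg_carrier = {f \<in> M \<rightarrow>\<^sub>E M. (\<forall>x\<in>M. \<forall>y\<in>M. f (x + y) = f x + f y) \<and>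
                                   (\<forall>c. \<forall>x\<in>M. f (sc c x) = sc c (f x))},
     alg_add = (\<lambda>f g. \<lambda>x\<in>M. f x + g x),
     alg_mult = (\<lambda>f g. compose M f g),
     alg_scale = (\<lambda>c f. \<lambda>x\<in>M. sc c (f x))\<rparr>"

definition is_representation ::
    "('r::comm_ring_1 \<Rightarrow> 'm::ab_group_add \<Rightarrow> 'm) \<Rightarrow> ('a, 'r) alg \<Rightarrow> 'm set \<Rightarrow> ('a \<Rightarrow> 'm \<Rightarrow> 'm) \<Rightarrow> bool" where
  "is_representation sc A M \<phi> \<longleftrightarrow> module.subspace sc M \<and> alg_hom A (End_alg sc M) \<phi>"

definition irreducible_representation ::
    "('r::comm_ring_1 \<Rightarrow> 'm::ab_group_add \<Rightarrow> 'm) \<Rightarrow> ('a, 'r) alg \<Rightarrow> 'm set \<Rightarrow> ('a \<Rightarrow> 'm \<Rightarrow> 'm) \<Rightarrow> bool" where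
  "irreducible_representation sc A M \<phi> \<longleftrightarrow>
     is_representation sc A M \<phi> \<and> M \<noteq> {0} \<and>
     (\<forall>N. module.subspace sc N \<and> N \<subseteq> M \<and> (\<forall>x\<in>alg_carrier A. \<phi> x ` N \<subseteq> N) \<longrightarrow>
          N = {0} \<or> N = M)"

section \<open>Free modules and free algebras\<close>

text \<open>The free \<open>R\<close>-module with basis a type \<open>'a\<close> is \<open>'a \<Rightarrow>\<^sub>0 'r\<close>, the element \<open>a\<close> of the basis
  being \<open>single a 1\<close>.\<close>

definition pscale :: "'r \<Rightarrow> ('a \<Rightarrow>\<^sub>0 'r) \<Rightarrow> ('a \<Rightarrow>\<^sub>0 'r::comm_ring_1)" where
  "pscale c x = Poly_Mapping.map ((*) c) x"

lemma lookup_pscale [simp]: "Poly_Mapping.lookup (pscale c x) a = c * Poly_Mapping.lookup x a"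
  by (simp add: pscale_def Poly_Mapping.map.rep_eq when_def)

interpretation fm: module "pscale :: 'r::comm_ring_1 \<Rightarrow> ('a \<Rightarrow>\<^sub>0 'r) \<Rightarrow> ('a \<Rightarrow>\<^sub>0 'r)"
  by unfold_locales (simp_all add: poly_mapping_eq_iff fun_eq_iff lookup_add algebra_simps)

definition lin_ext :: "('a \<Rightarrow> 'b \<Rightarrow>\<^sub>0 'r) \<Rightarrow> ('a \<Rightarrow>\<^sub>0 'r) \<Rightarrow> ('b \<Rightarrow>\<^sub>0 'r::comm_ring_1)" where
  "lin_ext f x = (\<Sum>a\<in>Poly_Mapping.keys x. pscale (Poly_Mapping.lookup x a) (f a))"

text \<open>Lists under concatenation form the free monoid. With this instance the multiplication of
  \<open>'g list \<Rightarrow>\<^sub>0 'r\<close> provided by \<open>Poly_Mapping\<close> (convolution) is the one of the monoid algebra of the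
  free monoid, which is the free unital algebra on \<open>'g\<close>.\<close>

instantiation list :: (type) monoid_add
begin

definition zero_list :: "'a list" where "0 = []"

definition plus_list :: "'a list \<Rightarrow> 'a list \<Rightarrow> 'a list" where "xs + ys = xs @ ys"

instance by standard (simp_all add: zero_list_def plus_list_def)

end

text \<open>The free not necessarily unital algebra on a set \<open>X\<close> of generators: no empty word.\<close>

definition free_algebra :: "'g set \<Rightarrow> ('g list \<Rightarrow>\<^sub>0 'r::comm_ring_1) set" where
  "free_algebra X = fm.span {Poly_Mapping.single w 1 | w. w \<noteq> [] \<and> set w \<subseteq> X}"

definition two_sided_ideal :: "('g list \<Rightarrow>\<^sub>0 'r::comm_ring_1) set \<Rightarrow> ('g list \<Rightarrow>\<^sub>0 'r) set \<Rightarrow> bool" where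
  "two_sided_ideal F I \<longleftrightarrow> I \<subseteq> F \<and> fm.subspace I \<and> (\<forall>a\<in>F. \<forall>x\<in>I. a * x \<in> I \<and> x * a \<in> I)"

definition quot_rel :: "('g list \<Rightarrow>\<^sub>0 'r::comm_ring_1) set \<Rightarrow> ('g list \<Rightarrow>\<^sub>0 'r) set \<Rightarrow>
    (('g list \<Rightarrow>\<^sub>0 'r) \<times> ('g list \<Rightarrow>\<^sub>0 'r)) set" where
  "quot_rel F I = {(x, y). x \<in> F \<and> y \<in> F \<and> x - y \<in> I}"

text \<open>The algebra presented by the generators \<open>X\<close> and the relations \<open>x = 0\<close> for \<open>x \<in> W\<close>; its
  elements are the cosets of the ideal generated by \<open>W\<close>.\<close>

definition presented_rel :: "'g set \<Rightarrow> ('g list \<Rightarrow>\<^sub>0 'r::comm_ring_1) set \<Rightarrow>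
    (('g list \<Rightarrow>\<^sub>0 'r) \<times> ('g list \<Rightarrow>\<^sub>0 'r)) set" where
  "presented_rel X W = quot_rel (free_algebra X) (two_sided_ideal (free_algebra X) hull W)"

definition presented_algebra ::
    "'g set \<Rightarrow> ('g list \<Rightarrow>\<^sub>0 'r::comm_ring_1) set \<Rightarrow> (('g list \<Rightarrow>\<^sub>0 'r) set, 'r) alg" where
  "presented_algebra X W = (let q = presented_rel X W in \<lparr>
     alg_carrier = free_algebra X // q,
     alg_add = (\<lambda>S T. \<Union>x\<in>S. \<Union>y\<in>T. q `` {x + y}),
     alg_mult = (\<lambda>S T. \<Union>x\<in>S. \<Union>y\<in>T. q `` {x * y}),
     alg_scale = (\<lambda>c S. \<Union>x\<in>S. q `` {pscale c x})\<rparr>)"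

section \<open>Ultragraphs\<close>

record ('v, 'e) ultragraph =
  verts :: "'v set"
  edges :: "'e set"
  src :: "'e \<Rightarrow> 'v"
  rng :: "'e \<Rightarrow> 'v set"

definition ultragraph :: "('v, 'e) ultragraph \<Rightarrow> bool" where
  "ultragraph G \<longleftrightarrow>
     countable (verts G) \<and> countable (edges G) \<and>
     src G \<in> edges G \<rightarrow> verts G \<and>
     rng G \<in> edges G \<rightarrow> Pow (verts G) - {{}}"

text \<open>The collection of generalized vertices, as least family with the stated closure properties. The
  empty union is included, so that \<open>{}\<close> belongs to it; only non-empty families are intersected.\<close>

inductive_set gen_verts :: "('v, 'e) ultragraph \<Rightarrow> 'v set set" for G where
  vertex: "v \<in> verts G \<Longrightarrow> {v} \<in> gen_verts G"
| range: "e \<in> edges G \<Longrightarrow> rng G e \<in> gen_verts G"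
| Union: "finite \<F> \<Longrightarrow> \<forall>A\<in>\<F>. A \<in> gen_verts G \<Longrightarrow> \<Union>\<F> \<in> gen_verts G"
| Inter: "finite \<F> \<Longrightarrow> \<F> \<noteq> {} \<Longrightarrow> \<forall>A\<in>\<F>. A \<in> gen_verts G \<Longrightarrow> \<Inter>\<F> \<in> gen_verts G"

definition sinks :: "('v, 'e) ultragraph \<Rightarrow> 'v set" where
  "sinks G = {v \<in> verts G. {e \<in> edges G. src G e = v} = {}}"

section \<open>The Leavitt path algebra of an ultragraph\<close>

datatype ('v, 'e) generator = Proj "'v set" | Edge 'e | EdgeStar 'e

definition generators :: "('v, 'e) ultragraph \<Rightarrow> ('v, 'e) generator set" where
  "generators G = Proj ` gen_verts G \<union> Edge ` edges G \<union> EdgeStar ` edges G"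

abbreviation gen :: "'g \<Rightarrow> ('g list \<Rightarrow>\<^sub>0 'r::comm_ring_1)" where
  "gen g \<equiv> Poly_Mapping.single [g] 1"

abbreviation gp :: "'v set \<Rightarrow> (('v, 'e) generator list \<Rightarrow>\<^sub>0 'r::comm_ring_1)" where
  "gp A \<equiv> gen (Proj A)"

abbreviation gs :: "'e \<Rightarrow> (('v, 'e) generator list \<Rightarrow>\<^sub>0 'r::comm_ring_1)" where
  "gs e \<equiv> gen (Edge e)"

abbreviation gs_star :: "'e \<Rightarrow> (('v, 'e) generator list \<Rightarrow>\<^sub>0 'r::comm_ring_1)" where
  "gs_star e \<equiv> gen (EdgeStar e)"

definition leavitt_relations ::
    "('v, 'e) ultragraph \<Rightarrow> (('v, 'e) generator list \<Rightarrow>\<^sub>0 'r::comm_ring_1) set" where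
  "leavitt_relations G =
     {gp {}}
     \<union> {gp A * gp B - gp (A \<inter> B) | A B. A \<in> gen_verts G \<and> B \<in> gen_verts G}
     \<union> {gp (A \<union> B) - (gp A + gp B - gp (A \<inter> B)) | A B. A \<in> gen_verts G \<and> B \<in> gen_verts G}
     \<union> {gp {src G e} * gs e - gs e | e. e \<in> edges G}
     \<union> {gs e * gp (rng G e) - gs e | e. e \<in> edges G}
     \<union> {gp (rng G e) * gs_star e - gs_star e | e. e \<in> edges G}
     \<union> {gs_star e * gp {src G e} - gs_star e | e. e \<in> edges G}
     \<union> {gs_star e * gs f - (if e = f then gp (rng G e) else 0) | e f. e \<in> edges G \<and> f \<in> edges G}
     \<union> {gp {v} - (\<Sum>e\<in>{e \<in> edges G. src G e = v}. gs e * gs_star e) | v.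
          v \<in> verts G \<and> finite {e \<in> edges G. src G e = v} \<and> {e \<in> edges G. src G e = v} \<noteq> {}}"

definition leavitt_algebra ::
    "('v, 'e) ultragraph \<Rightarrow> ((('v, 'e) generator list \<Rightarrow>\<^sub>0 'r::comm_ring_1) set, 'r) alg" where
  "leavitt_algebra G = presented_algebra (generators G) (leavitt_relations G)"

section \<open>Paths\<close>

text \<open>\<open>FinPath a v\<close> with \<open>a \<noteq> []\<close> is the pair of the finite path \<open>a\<close> and the sink \<open>v\<close>, and \<open>FinPath [] v\<close> is
  \<open>(v, v)\<close>. The edges of an infinite path are numbered from 0.\<close>

datatype ('v, 'e) path = FinPath "'e list" 'v | InfPath "nat \<Rightarrow> 'e"

definition finite_path :: "('v, 'e) ultragraph \<Rightarrow> 'e list \<Rightarrow> bool" where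
  "finite_path G a \<longleftrightarrow> a \<noteq> [] \<and> set a \<subseteq> edges G \<and>
     (\<forall>i. Suc i < length a \<longrightarrow> src G (a ! Suc i) \<in> rng G (a ! i))"

definition infinite_path :: "('v, 'e) ultragraph \<Rightarrow> (nat \<Rightarrow> 'e) \<Rightarrow> bool" where
  "infinite_path G x \<longleftrightarrow> (\<forall>i. x i \<in> edges G) \<and> (\<forall>i. src G (x (Suc i)) \<in> rng G (x i))"

definition fin_paths :: "('v, 'e) ultragraph \<Rightarrow> ('v, 'e) path set" where
  "fin_paths G = {FinPath a v | a v. finite_path G a \<and> v \<in> rng G (last a) \<inter> sinks G}
     \<union> {FinPath [] v | v. v \<in> sinks G}"

definition inf_paths :: "('v, 'e) ultragraph \<Rightarrow> ('v, 'e) path set" where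
  "inf_paths G = {InfPath x | x. infinite_path G x}"

definition paths :: "('v, 'e) ultragraph \<Rightarrow> ('v, 'e) path set" where
  "paths G = fin_paths G \<union> inf_paths G"

definition path_equiv :: "('v, 'e) ultragraph \<Rightarrow> (('v, 'e) path \<times> ('v, 'e) path) set" where
  "path_equiv G =
     {(InfPath x, InfPath y) | x y. InfPath x \<in> inf_paths G \<and> InfPath y \<in> inf_paths G \<and>
        (\<exists>i j. \<forall>k. x (i + k) = y (j + k))}
     \<union> {(FinPath a v, FinPath b v) | a b v. FinPath a v \<in> fin_paths G \<and> FinPath b v \<in> fin_paths G}"

fun path_src :: "('v, 'e) ultragraph \<Rightarrow> ('v, 'e) path \<Rightarrow> 'v" where
  "path_src G (FinPath [] v) = v"
| "path_src G (FinPath (e # a) v) = src G e"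
| "path_src G (InfPath x) = src G (x 0)"

fun path_cons :: "'e \<Rightarrow> ('v, 'e) path \<Rightarrow> ('v, 'e) path" where
  "path_cons e (FinPath a v) = FinPath (e # a) v"
| "path_cons e (InfPath x) = InfPath (case_nat e x)"

text \<open>The result of removing the initial edge \<open>e\<close>, if the path starts with \<open>e\<close>.\<close>

fun path_uncons :: "'e \<Rightarrow> ('v, 'e) path \<Rightarrow> ('v, 'e) path option" where
  "path_uncons e (FinPath [] v) = None"
| "path_uncons e (FinPath (f # a) v) = (if f = e then Some (FinPath a v) else None)"
| "path_uncons e (InfPath x) = (if x 0 = e then Some (InfPath (\<lambda>n. x (Suc n))) else None)"

section \<open>The representation on the free module of paths\<close>

abbreviation path_basis :: "('v, 'e) path \<Rightarrow> (('v, 'e) path \<Rightarrow>\<^sub>0 'r::comm_ring_1)" where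
  "path_basis \<alpha> \<equiv> Poly_Mapping.single \<alpha> 1"

text \<open>The submodule generated by the basis elements indexed by a set of paths: for \<open>paths G\<close> this is
  the whole free module on the paths, for an equivalence class \<open>c\<close> it is the submodule of \<open>c\<close>.\<close>

definition path_module :: "('v, 'e) path set \<Rightarrow> (('v, 'e) path \<Rightarrow>\<^sub>0 'r::comm_ring_1) set" where
  "path_module S = fm.span (path_basis ` S)"

fun gen_act :: "('v, 'e) ultragraph \<Rightarrow> ('v, 'e) generator \<Rightarrow> ('v, 'e) path \<Rightarrow>
    (('v, 'e) path \<Rightarrow>\<^sub>0 'r::comm_ring_1)" where
  "gen_act G (Proj A) \<alpha> = (if path_src G \<alpha> \<in> A then path_basis \<alpha> else 0)"
| "gen_act G (Edge e) \<alpha> = (if path_src G \<alpha> \<in> rng G e then path_basis (path_cons e \<alpha>) else 0)"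
| "gen_act G (EdgeStar e) \<alpha> =
     (case path_uncons e \<alpha> of Some \<beta> \<Rightarrow> path_basis \<beta> | None \<Rightarrow> 0)"

definition free_act :: "('v, 'e) ultragraph \<Rightarrow> (('v, 'e) generator list \<Rightarrow>\<^sub>0 'r::comm_ring_1) \<Rightarrow>
    (('v, 'e) path \<Rightarrow>\<^sub>0 'r) \<Rightarrow> (('v, 'e) path \<Rightarrow>\<^sub>0 'r)" where
  "free_act G x \<xi> = lin_ext (\<lambda>w. foldr (\<lambda>g. lin_ext (gen_act G g)) w \<xi>) x"

text \<open>The value on a coset is the common value of its representatives.\<close>

definition path_rep :: "('v, 'e) ultragraph \<Rightarrow> (('v, 'e) generator list \<Rightarrow>\<^sub>0 'r::comm_ring_1) set \<Rightarrow>
    (('v, 'e) path \<Rightarrow>\<^sub>0 'r) \<Rightarrow> (('v, 'e) path \<Rightarrow>\<^sub>0 'r)" where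
  "path_rep G X = the_elem ((\<lambda>x. restrict (free_act G x) (path_module (paths G))) ` X)"

definition class_rep :: "('v, 'e) ultragraph \<Rightarrow> ('v, 'e) path set \<Rightarrow>
    (('v, 'e) generator list \<Rightarrow>\<^sub>0 'r::comm_ring_1) set \<Rightarrow>
    (('v, 'e) path \<Rightarrow>\<^sub>0 'r) \<Rightarrow> (('v, 'e) path \<Rightarrow>\<^sub>0 'r)" where
  "class_rep G c X = restrict (path_rep G X) (path_module c)"

end

theory Submission
  imports Defs
begin

text \<open>
  Two paths are equivalent exactly when they arise from one path \<open>\<delta>\<close> by prepending finite lists of
  edges \<open>a\<close> and \<open>d\<close>; for paths ending in a sink \<open>v\<close> one takes \<open>\<delta> = (v, v)\<close>. Write \<open>S\<^sub>d\<close> for the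
  product of the \<open>s\<^sub>e\<close> along \<open>d\<close>, and \<open>S\<^sub>a\<^sup>*\<close> for the product of the \<open>s\<^sub>e\<^sup>*\<close> along \<open>a\<close> in reverse order.
  The element \<open>S\<^sub>a\<^sup>*\<close> sends \<open>b\<^bsub>a\<delta>\<^esub>\<close> to \<open>b\<^bsub>\<delta>\<^esub>\<close> and annihilates every basis element whose path does not
  begin with \<open>a\<close>, and \<open>S\<^sub>d\<close> sends \<open>b\<^bsub>\<delta>\<^esub>\<close> to \<open>b\<^bsub>d\<delta>\<^esub>\<close> if \<open>d\<delta>\<close> is a path. Hence, in the module of a class,
  an invariant submodule that contains one basis element contains all of them
  (\<open>move_along_common_tail\<close>).

  It remains to find a basis element in a nonzero invariant submodule \<open>N\<close>. Let \<open>\<xi> \<noteq> 0\<close> in \<open>N\<close> have the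
  smallest possible support. If the support contained two paths, then some finite list of edges \<open>a\<close>
  would be an initial piece of exactly one of them (\<open>separating_prefix\<close>). Stripping \<open>a\<close> is injective
  where it is defined, so \<open>S\<^sub>a\<^sup>* \<xi>\<close> would be nonzero with smaller support (\<open>smaller_support\<close>). Hence \<open>\<xi>\<close>
  is a scalar multiple of a basis element, and the scalar is invertible because \<open>R\<close> is a field.

  Irreducibility also asserts that the action is a representation of the Leavitt path algebra, which
  holds over every commutative ring. The free algebra acts multiplicatively (\<open>free_act_mult\<close>), each
  relation acts as zero on paths (\<open>leavitt_relation_act\<close>), and the elements acting as zero form a
  two-sided ideal, so that the ideal generated by the relations acts as zero
  (\<open>presented_rel_act\<close>).
\<close>

section \<open>Linear maps between free modules\<close>

abbreviation pm_linear :: "(('a \<Rightarrow>\<^sub>0 'r) \<Rightarrow> ('b \<Rightarrow>\<^sub>0 'r::comm_ring_1)) \<Rightarrow> bool" where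
  "pm_linear \<equiv> module_hom pscale pscale"

lemma pm_linearI:
  assumes "\<And>x y. f (x + y) = f x + f y" and "\<And>c x. f (pscale c x) = pscale c (f x)"
  shows "pm_linear f"
  unfolding module_hom_iff using assms by (simp add: fm.module_axioms)

lemma pscale_single [simp]: "pscale c (Poly_Mapping.single a d) = Poly_Mapping.single a (c * d)"
  by (rule poly_mapping_eqI) (simp add: lookup_single when_def)

lemma keys_pscale: "Poly_Mapping.keys (pscale c x) \<subseteq> Poly_Mapping.keys x"
  by (auto simp: in_keys_iff)

lemma sum_pscale_single:
  "(\<Sum>a\<in>Poly_Mapping.keys x. pscale (Poly_Mapping.lookup x a) (Poly_Mapping.single a 1)) = x"
  by (rule poly_mapping_eqI)
    (auto simp: lookup_sum lookup_single when_def in_keys_iff)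

text \<open>The singles carry arbitrary coefficients here, so that an identity between additive maps can be
  checked on singles alone, without knowing that the maps respect scalars.\<close>

lemma poly_mapping_additive_induct [case_names single add]:
  fixes x :: "'a \<Rightarrow>\<^sub>0 'r::comm_ring_1"
  assumes "\<And>a c. P (Poly_Mapping.single a c)" and "\<And>x y. P x \<Longrightarrow> P y \<Longrightarrow> P (x + y)"
  shows "P x"
proof -
  have "P (\<Sum>a\<in>A. pscale (Poly_Mapping.lookup x a) (Poly_Mapping.single a 1))" if "finite A" for A
    using that
  proof (induction A)
    case empty
    then show ?case using assms(1)[of _ 0] by simp
  next
    case (insert a A)
    then show ?case using assms by simp
  qed
  from this[OF finite_keys[of x]] show ?thesis by (simp only: sum_pscale_single)
qed

text \<open>Both the modules of paths and the free algebra are spans of basis elements. Describing such a span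
  by supports reduces closure properties to inclusions between sets of keys.\<close>

lemma span_singles:
  "fm.span ((\<lambda>a. Poly_Mapping.single a 1) ` S) =
    {x :: 'a \<Rightarrow>\<^sub>0 'r::comm_ring_1. Poly_Mapping.keys x \<subseteq> S}" (is "?A = ?B")
proof
  have "fm.subspace ?B"
    by (auto simp: fm.subspace_def dest!: subsetD[OF keys_add] subsetD[OF keys_pscale])
  then show "?A \<subseteq> ?B"
    by (intro fm.span_minimal) auto
  show "?B \<subseteq> ?A"
  proof clarify
    fix x :: "'a \<Rightarrow>\<^sub>0 'r" assume "Poly_Mapping.keys x \<subseteq> S"
    then have "(\<Sum>a\<in>Poly_Mapping.keys x. pscale (Poly_Mapping.lookup x a) (Poly_Mapping.single a 1))
        \<in> ?A"
      by (intro fm.span_sum fm.span_scale fm.span_base) auto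
    then show "x \<in> ?A"
      by (simp only: sum_pscale_single)
  qed
qed

lemma lin_ext_eq_sum:
  assumes "finite K" "Poly_Mapping.keys x \<subseteq> K"
  shows "lin_ext f x = (\<Sum>a\<in>K. pscale (Poly_Mapping.lookup x a) (f a))"
  unfolding lin_ext_def using assms by (intro sum.mono_neutral_left) (auto simp: in_keys_iff)

lemma pm_linear_lin_ext:
  fixes f :: "'a \<Rightarrow> 'b \<Rightarrow>\<^sub>0 'r::comm_ring_1"
  shows "pm_linear (lin_ext f)"
proof (rule pm_linearI)
  fix x y :: "'a \<Rightarrow>\<^sub>0 'r" and c
  let ?K = "Poly_Mapping.keys x \<union> Poly_Mapping.keys y"
  have "lin_ext f (x + y) = (\<Sum>a\<in>?K. pscale (Poly_Mapping.lookup (x + y) a) (f a))"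
    by (intro lin_ext_eq_sum keys_add) simp
  also have "\<dots> = (\<Sum>a\<in>?K. pscale (Poly_Mapping.lookup x a) (f a))
      + (\<Sum>a\<in>?K. pscale (Poly_Mapping.lookup y a) (f a))"
    by (simp add: lookup_add fm.scale_left_distrib sum.distrib)
  also have "\<dots> = lin_ext f x + lin_ext f y"
    by (simp flip: lin_ext_eq_sum[of ?K])
  finally show "lin_ext f (x + y) = lin_ext f x + lin_ext f y" .
  show "lin_ext f (pscale c x) = pscale c (lin_ext f x)"
    using lin_ext_eq_sum[OF finite_keys keys_pscale, of f c x]
    by (simp add: lin_ext_def fm.scale_sum_right)
qed

lemmas lin_ext_add = module_hom.add[OF pm_linear_lin_ext]
  and lin_ext_scale = module_hom.scale[OF pm_linear_lin_ext]
  and lin_ext_zero [simp] = module_hom.zero[OF pm_linear_lin_ext]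

lemma lin_ext_single [simp]: "lin_ext f (Poly_Mapping.single a c) = pscale c (f a)"
  by (simp add: lin_ext_def)

lemma keys_lin_ext:
  assumes "\<And>a. a \<in> Poly_Mapping.keys x \<Longrightarrow> Poly_Mapping.keys (f a) \<subseteq> S"
  shows "Poly_Mapping.keys (lin_ext f x) \<subseteq> S"
proof
  fix b assume "b \<in> Poly_Mapping.keys (lin_ext f x)"
  then have "(\<Sum>a\<in>Poly_Mapping.keys x. Poly_Mapping.lookup x a * Poly_Mapping.lookup (f a) b) \<noteq> 0"
    by (simp add: in_keys_iff lin_ext_def lookup_sum)
  then obtain a where "a \<in> Poly_Mapping.keys x" "Poly_Mapping.lookup (f a) b \<noteq> 0"
    by (metis (no_types, lifting) mult_zero_right sum.neutral)
  then show "b \<in> S" using assms by (auto simp: subset_iff in_keys_iff)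
qed

lemma pm_linear_zero_on:
  assumes "pm_linear f" and "\<And>a. a \<in> S \<Longrightarrow> f (Poly_Mapping.single a 1) = 0"
    and "Poly_Mapping.keys x \<subseteq> S"
  shows "f x = 0"
proof -
  interpret module_hom pscale pscale f by fact
  have "f (\<Sum>a\<in>Poly_Mapping.keys x. pscale (Poly_Mapping.lookup x a) (Poly_Mapping.single a 1)) = 0"
    using assms(2,3) by (simp add: sum scale subset_iff del: pscale_single)
  then show ?thesis by (simp only: sum_pscale_single)
qed

section \<open>The action of the free algebra\<close>

abbreviation word_act :: "('v, 'e) ultragraph \<Rightarrow> ('v, 'e) generator list \<Rightarrow>
    (('v, 'e) path \<Rightarrow>\<^sub>0 'r) \<Rightarrow> (('v, 'e) path \<Rightarrow>\<^sub>0 'r::comm_ring_1)" where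
  "word_act G w \<equiv> foldr (\<lambda>g. lin_ext (gen_act G g)) w"

lemma pm_linear_word_act: "pm_linear (word_act G w)"
  by (rule pm_linearI; induction w) (simp_all add: lin_ext_add lin_ext_scale)

lemma pm_linear_free_act:
  fixes x :: "('v, 'e) generator list \<Rightarrow>\<^sub>0 'r::comm_ring_1"
  shows "pm_linear (free_act G x)"
proof (rule pm_linearI)
  fix \<xi> \<eta> :: "('v, 'e) path \<Rightarrow>\<^sub>0 'r" and c
  note word = pm_linear_word_act[of G]
  show "free_act G x (\<xi> + \<eta>) = free_act G x \<xi> + free_act G x \<eta>"
    by (simp add: free_act_def lin_ext_def module_hom.add[OF word] fm.scale_right_distrib sum.distrib)
  show "free_act G x (pscale c \<xi>) = pscale c (free_act G x \<xi>)"
    by (simp add: free_act_def lin_ext_def module_hom.scale[OF word] fm.scale_sum_right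
        mult.commute)
qed

lemma pm_linear_free_act_left: "pm_linear (\<lambda>x. free_act G x \<xi>)"
  unfolding free_act_def by (rule pm_linear_lin_ext)

lemmas free_act_add = module_hom.add[OF pm_linear_free_act_left]
  and free_act_diff = module_hom.diff[OF pm_linear_free_act_left]
  and free_act_zero = module_hom.zero[OF pm_linear_free_act_left]
  and free_act_sum = module_hom.sum[OF pm_linear_free_act_left]
  and free_act_scale = module_hom.scale[OF pm_linear_free_act_left]
  and free_act_add_right = module_hom.add[OF pm_linear_free_act]
  and free_act_scale_right = module_hom.scale[OF pm_linear_free_act]
  and free_act_zero_right = module_hom.zero[OF pm_linear_free_act]

lemma free_act_single: "free_act G (Poly_Mapping.single w c) \<xi> = pscale c (word_act G w \<xi>)"
  by (simp add: free_act_def)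

text \<open>On words this is the compatibility of \<open>foldr\<close> with concatenation; both sides are additive in \<open>x\<close>
  and in \<open>y\<close>.\<close>

lemma free_act_mult: "free_act G (x * y) \<xi> = free_act G x (free_act G y \<xi>)"
proof (induction x rule: poly_mapping_additive_induct)
  case (single u c)
  show ?case
    by (induction y rule: poly_mapping_additive_induct)
      (simp_all add: mult_single free_act_single plus_list_def distrib_left free_act_add
        free_act_add_right fm.scale_right_distrib
        module_hom.add[OF pm_linear_word_act] module_hom.scale[OF pm_linear_word_act])
qed (simp add: distrib_right free_act_add)

lemma free_algebra_eq:
  "free_algebra X = {x. Poly_Mapping.keys x \<subseteq> {w. w \<noteq> [] \<and> set w \<subseteq> X}}"
  unfolding free_algebra_def span_singles[symmetric]
  by (rule arg_cong[of _ _ fm.span]) auto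

lemma free_algebra_subspace: "fm.subspace (free_algebra X)"
  unfolding free_algebra_def by (rule fm.subspace_span)

text \<open>A concatenation of non-empty words is non-empty, so the free algebra without unit is closed under
  convolution.\<close>

lemma free_algebra_mult:
  assumes "x \<in> free_algebra X" "y \<in> free_algebra X"
  shows "x * y \<in> free_algebra X"
proof -
  have "w \<noteq> [] \<and> set w \<subseteq> X" if "w \<in> Poly_Mapping.keys (x * y)" for w
    using that assms keys_mult[of x y] by (fastforce simp: free_algebra_eq plus_list_def)
  then show ?thesis by (auto simp: free_algebra_eq)
qed

lemma gen_in_free_algebra: "g \<in> X \<Longrightarrow> gen g \<in> free_algebra X"
  by (simp add: free_algebra_eq)

section \<open>Paths and their first edges\<close>

lemma path_src_cons [simp]: "path_src G (path_cons e \<alpha>) = src G e"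
  by (cases \<alpha>) auto

text \<open>Removing and adding a first edge are mutually inverse. Together with \<open>path_cons_in_paths_iff\<close> this
  lets finite and infinite paths be treated alike from here on.\<close>

lemma path_uncons_eq_Some_iff: "path_uncons e \<alpha> = Some \<beta> \<longleftrightarrow> \<alpha> = path_cons e \<beta>"
proof (cases \<alpha>)
  case (FinPath a v)
  then show ?thesis by (cases a; cases \<beta>) auto
next
  case (InfPath x)
  then show ?thesis by (cases \<beta>) (auto simp: fun_eq_iff split: nat.split)
qed

lemma path_uncons_cons [simp]:
  "path_uncons e (path_cons f \<alpha>) = (if e = f then Some \<alpha> else None)"
  by (cases \<alpha>) (auto simp: fun_eq_iff)

lemma path_cons_inject [simp]: "path_cons e \<alpha> = path_cons f \<beta> \<longleftrightarrow> e = f \<and> \<alpha> = \<beta>"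
  by (metis option.inject option.distinct(1) path_uncons_cons)

lemma finite_path_Cons:
  "finite_path G (e # a) \<longleftrightarrow>
    e \<in> edges G \<and> (a = [] \<or> finite_path G a \<and> src G (hd a) \<in> rng G e)"
proof (cases a)
  case (Cons f b)
  have "(\<forall>i. Suc i < length (e # a) \<longrightarrow> src G ((e # a) ! Suc i) \<in> rng G ((e # a) ! i)) \<longleftrightarrow>
    src G f \<in> rng G e \<and> (\<forall>i. Suc i < length a \<longrightarrow> src G (a ! Suc i) \<in> rng G (a ! i))"
    (is "(\<forall>i. ?P i) \<longleftrightarrow> ?Q \<and> (\<forall>i. ?R i)")
  proof -
    have "?P 0 \<longleftrightarrow> ?Q" "\<And>i. ?P (Suc i) \<longleftrightarrow> ?R i" using Cons by auto
    then show ?thesis by (metis not0_implies_Suc)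
  qed
  then show ?thesis using Cons unfolding finite_path_def by auto
qed (simp add: finite_path_def)

lemma infinite_path_case_nat:
  "infinite_path G (case_nat e x) \<longleftrightarrow>
    e \<in> edges G \<and> infinite_path G x \<and> src G (x 0) \<in> rng G e"
proof -
  have all: "(\<forall>i. P i) \<longleftrightarrow> P 0 \<and> (\<forall>i. P (Suc i))" for P
    by (metis not0_implies_Suc)
  show ?thesis
    unfolding infinite_path_def all[of "\<lambda>i. case_nat e x i \<in> edges G"]
      all[of "\<lambda>i. src G (case_nat e x (Suc i)) \<in> rng G (case_nat e x i)"]
    by auto
qed

lemma path_cons_in_paths_iff:
  "path_cons e \<alpha> \<in> paths G \<longleftrightarrow> e \<in> edges G \<and> \<alpha> \<in> paths G \<and> path_src G \<alpha> \<in> rng G e"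
proof (cases \<alpha>)
  case (FinPath a v)
  then show ?thesis
    by (cases a) (auto simp: paths_def fin_paths_def inf_paths_def finite_path_Cons)
next
  case (InfPath x)
  then show ?thesis
    by (auto simp: paths_def fin_paths_def inf_paths_def infinite_path_case_nat)
qed

text \<open>Only the trivial path at a sink has no first edge. This is where it matters that finite paths end
  in sinks: otherwise the last relation would fail on the trivial path at a vertex with finitely many outgoing
  edges, at least one of them.\<close>

lemma path_cases:
  assumes "\<alpha> \<in> paths G"
  obtains (sink) v where "v \<in> sinks G" "\<alpha> = FinPath [] v"
  | (cons) e \<beta> where "\<alpha> = path_cons e \<beta>"
proof (cases \<alpha>)
  case (FinPath a v)
  then show ?thesis
  proof (cases a)
    case Nil
    then have "v \<in> sinks G"
      using assms FinPath by (auto simp: paths_def fin_paths_def inf_paths_def)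
    then show ?thesis using sink Nil FinPath by simp
  next
    case (Cons e b)
    then show ?thesis using cons[of e "FinPath b v"] FinPath by simp
  qed
next
  case (InfPath x)
  have "x = case_nat (x 0) (\<lambda>n. x (Suc n))" by (auto simp: fun_eq_iff split: nat.split)
  then show ?thesis using cons[of "x 0" "InfPath (\<lambda>n. x (Suc n))"] InfPath by simp
qed

section \<open>The relations hold for the action on paths\<close>

lemma free_act_gen [simp]: "free_act G (gen g) \<xi> = lin_ext (gen_act G g) \<xi>"
  by (simp add: free_act_single)

text \<open>A path starting at \<open>v\<close> has a first edge \<open>f\<close> because \<open>v\<close> emits edges. The summand at \<open>f\<close> removes this
  edge and puts it back, and every other summand is zero.\<close>

lemma vertex_relation_act:
  assumes "\<alpha> \<in> paths G" and fin: "finite {e \<in> edges G. src G e = v}"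
    and ne: "{e \<in> edges G. src G e = v} \<noteq> {}"
  shows "free_act G (gp {v} - (\<Sum>e\<in>{e \<in> edges G. src G e = v}. gs e * gs_star e))
    (path_basis \<alpha> :: ('v, 'e) path \<Rightarrow>\<^sub>0 'r::comm_ring_1) = 0"
  using assms(1)
proof (cases rule: path_cases)
  case (sink w)
  then have "w \<noteq> v" using ne by (auto simp: sinks_def)
  then show ?thesis
    by (simp add: sink free_act_diff free_act_sum free_act_mult)
next
  case (cons f \<beta>)
  have \<beta>: "f \<in> edges G" "path_src G \<beta> \<in> rng G f"
    using assms(1) by (auto simp: cons path_cons_in_paths_iff)
  have "free_act G (gs e * gs_star e) (path_basis \<alpha> :: ('v, 'e) path \<Rightarrow>\<^sub>0 'r)
      = (if e = f then path_basis \<alpha> else 0)" for e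
    using \<beta> by (simp add: cons free_act_mult)
  then show ?thesis
    using \<beta> fin by (auto simp: cons free_act_diff free_act_sum)
qed

lemma leavitt_relation_act:
  fixes x :: "('v, 'e) generator list \<Rightarrow>\<^sub>0 'r::comm_ring_1"
  assumes "x \<in> leavitt_relations G" and \<alpha>: "\<alpha> \<in> paths G"
  shows "free_act G x (path_basis \<alpha>) = 0"
proof -
  have src: "path_src G \<beta> \<in> rng G e" if "path_uncons e \<alpha> = Some \<beta>" for e \<beta>
    using that \<alpha> by (simp add: path_uncons_eq_Some_iff path_cons_in_paths_iff)
  have src': "path_src G \<alpha> = src G e" if "path_uncons e \<alpha> = Some \<beta>" for e \<beta>
    using that by (auto simp: path_uncons_eq_Some_iff)
  note act = free_act_diff free_act_add free_act_mult free_act_zero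
  show ?thesis
    using assms(1) unfolding leavitt_relations_def
  proof (elim UnE)
    assume "x \<in> {gp {v} - (\<Sum>e\<in>{e \<in> edges G. src G e = v}. gs e * gs_star e) | v.
      v \<in> verts G \<and> finite {e \<in> edges G. src G e = v} \<and> {e \<in> edges G. src G e = v} \<noteq> {}}"
    then show ?thesis using vertex_relation_act[OF \<alpha>] by blast
  qed (auto simp: act src split: option.split dest!: src')
qed

lemma leavitt_relations_in_free_algebra:
  fixes G :: "('v, 'e) ultragraph"
  assumes "ultragraph G"
  shows "leavitt_relations G \<subseteq>
    (free_algebra (generators G) :: (('v, 'e) generator list \<Rightarrow>\<^sub>0 'r::comm_ring_1) set)"
proof -
  let ?F = "free_algebra (generators G) :: (('v, 'e) generator list \<Rightarrow>\<^sub>0 'r) set"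
  have gp: "gp A \<in> ?F" if "A \<in> gen_verts G" for A
    using that by (intro gen_in_free_algebra) (simp add: generators_def)
  have gs: "gs e \<in> ?F" "gs_star e \<in> ?F" if "e \<in> edges G" for e
    using that by (auto intro!: gen_in_free_algebra simp: generators_def)
  \<comment> \<open>the empty set is a generalized vertex, as the empty union\<close>
  have empty: "{} \<in> gen_verts G" using gen_verts.Union[of "{}" G] by simp
  have Un: "A \<union> B \<in> gen_verts G" and Int: "A \<inter> B \<in> gen_verts G"
    if "A \<in> gen_verts G" "B \<in> gen_verts G" for A B
    using that gen_verts.Union[of "{A, B}" G] gen_verts.Inter[of "{A, B}" G] by simp_all
  have src: "src G e \<in> verts G" if "e \<in> edges G" for e
    using that assms by (auto simp: ultragraph_def)
  note closed = fm.subspace_diff[OF free_algebra_subspace] fm.subspace_add[OF free_algebra_subspace]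
    fm.subspace_sum[OF free_algebra_subspace] fm.subspace_0[OF free_algebra_subspace]
    free_algebra_mult gp gs
  show ?thesis
    unfolding leavitt_relations_def
    by (intro Un_least subsetI)
      (auto intro!: closed empty Un Int src gen_verts.vertex gen_verts.range)
qed

section \<open>The representation on the module of a class of paths\<close>

text \<open>Sets of paths that are stable under adding and removing a first edge: these are the ones whose span
  is invariant. Both the set of all paths and each equivalence class are instances.\<close>

definition tail_closed :: "('v, 'e) ultragraph \<Rightarrow> ('v, 'e) path set \<Rightarrow> bool" where
  "tail_closed G S \<longleftrightarrow> S \<subseteq> paths G \<and>
    (\<forall>e \<alpha>. path_cons e \<alpha> \<in> paths G \<longrightarrow> (path_cons e \<alpha> \<in> S \<longleftrightarrow> \<alpha> \<in> S))"

lemma tail_closed_paths: "tail_closed G (paths G)"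
  by (auto simp: tail_closed_def path_cons_in_paths_iff)

lemma path_module_eq: "path_module S = {\<xi>. Poly_Mapping.keys \<xi> \<subseteq> S}"
  unfolding path_module_def by (rule span_singles)

lemma keys_gen_act:
  assumes "tail_closed G S" "g \<in> generators G" "\<alpha> \<in> S"
  shows "Poly_Mapping.keys (gen_act G g \<alpha> :: ('v, 'e) path \<Rightarrow>\<^sub>0 'r::comm_ring_1) \<subseteq> S"
proof (cases g)
  case (Proj A)
  then show ?thesis using assms by simp
next
  case (Edge e)
  then have "e \<in> edges G" using assms(2) by (auto simp: generators_def)
  then show ?thesis
    using assms(1,3) Edge by (auto simp: tail_closed_def path_cons_in_paths_iff)
next
  case (EdgeStar e)
  then show ?thesis
    using assms(1,3) by (auto simp: tail_closed_def path_uncons_eq_Some_iff split: option.split)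
qed

lemma free_act_in_path_module:
  assumes "tail_closed G S" "x \<in> free_algebra (generators G)" "\<xi> \<in> path_module S"
  shows "free_act G x \<xi> \<in> path_module S"
proof -
  have "Poly_Mapping.keys (word_act G w \<xi>) \<subseteq> S" if "set w \<subseteq> generators G" for w
    using that
  proof (induction w)
    case Nil
    then show ?case using assms(3) by (simp add: path_module_eq)
  next
    case (Cons g w)
    then have "Poly_Mapping.keys (lin_ext (gen_act G g) (word_act G w \<xi>)) \<subseteq> S"
      by (intro keys_lin_ext keys_gen_act[OF assms(1)]) auto
    then show ?case by simp
  qed
  then show ?thesis
    using assms(2) unfolding free_act_def path_module_eq free_algebra_eq
    by (auto intro!: keys_lin_ext)
qed

text \<open>For products with the annihilating factor on the left, it is essential that the other factor maps
  the module of all paths to itself: the annihilator is taken on that module only.\<close>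

lemma annihilator_two_sided_ideal:
  "two_sided_ideal (free_algebra (generators G))
    {x \<in> free_algebra (generators G). \<forall>\<xi>\<in>path_module (paths G). free_act G x \<xi> = 0}"
  (is "two_sided_ideal ?F ?I")
proof -
  have "fm.subspace ?I"
    using free_algebra_subspace[of "generators G"]
    by (auto simp: fm.subspace_def free_act_add free_act_scale free_act_zero)
  then show ?thesis
    unfolding two_sided_ideal_def
    using free_act_in_path_module[OF tail_closed_paths]
    by (auto simp: free_algebra_mult free_act_mult free_act_zero_right)
qed

text \<open>The ideal generated by the relations is the least one containing them, hence it lies in the
  annihilator.\<close>

lemma presented_rel_act:
  assumes "ultragraph G" and "(x, y) \<in> presented_rel (generators G) (leavitt_relations G)"
    and "\<xi> \<in> path_module (paths G)"
  shows "free_act G x \<xi> = free_act G y \<xi>"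
proof -
  let ?F = "free_algebra (generators G)"
  let ?I = "{x \<in> ?F. \<forall>\<xi>\<in>path_module (paths G). free_act G x \<xi> = 0}"
  have "free_act G r \<eta> = 0" if "r \<in> leavitt_relations G" "\<eta> \<in> path_module (paths G)" for r \<eta>
    using pm_linear_zero_on[OF pm_linear_free_act leavitt_relation_act[OF that(1)]] that(2)
    by (simp add: path_module_eq)
  then have "leavitt_relations G \<subseteq> ?I"
    using leavitt_relations_in_free_algebra[OF assms(1)] by auto
  then have "two_sided_ideal ?F hull leavitt_relations G \<subseteq> ?I"
    by (rule hull_minimal) (rule annihilator_two_sided_ideal)
  then have "x - y \<in> ?I" using assms(2) by (auto simp: presented_rel_def quot_rel_def)
  then show ?thesis using assms(3) by (simp add: free_act_diff)
qed

text \<open>The generated ideal is an intersection of ideals, all of which contain 0.\<close>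

lemma presented_rel_refl: "x \<in> free_algebra X \<Longrightarrow> (x, x) \<in> presented_rel X W"
  by (auto simp: presented_rel_def quot_rel_def hull_def two_sided_ideal_def fm.subspace_0)

text \<open>The representation is evaluated on any set of elements with a common action, not only on a coset.
  The operations of the presented algebra are unions of cosets, and in this form they can be evaluated
  without showing that these unions are single cosets.\<close>

lemma class_rep_eqI:
  fixes x :: "('v, 'e) generator list \<Rightarrow>\<^sub>0 'r::comm_ring_1"
  assumes "S \<subseteq> paths G" "x \<in> X"
    and "\<And>y \<xi>. y \<in> X \<Longrightarrow> \<xi> \<in> path_module (paths G) \<Longrightarrow> free_act G y \<xi> = free_act G x \<xi>"
  shows "class_rep G S X = restrict (free_act G x) (path_module S)"
proof -
  let ?M = "path_module (paths G) :: (('v, 'e) path \<Rightarrow>\<^sub>0 'r) set"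
  have "restrict (free_act G y) ?M = restrict (free_act G x) ?M" if "y \<in> X" for y
    using assms(3)[OF that] by (rule restrict_ext)
  then have "(\<lambda>y. restrict (free_act G y) ?M) ` X = {restrict (free_act G x) ?M}"
    using assms(2) by blast
  moreover have "?M \<inter> path_module S = path_module S"
    using assms(1) by (auto simp: path_module_eq)
  ultimately show ?thesis
    by (simp add: class_rep_def path_rep_def)
qed

lemma class_rep_coset:
  assumes "ultragraph G" "S \<subseteq> paths G" "x \<in> free_algebra (generators G)"
  shows "class_rep G S (presented_rel (generators G) (leavitt_relations G) `` {x}) =
    restrict (free_act G x) (path_module S)"
  using assms(2)
proof (rule class_rep_eqI)
  show "x \<in> presented_rel (generators G) (leavitt_relations G) `` {x}"
    using presented_rel_refl[OF assms(3)] by simp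
qed (simp add: presented_rel_act[OF assms(1)])

lemma leavitt_algebra_carrier:
  "alg_carrier (leavitt_algebra G) =
    (\<lambda>x. presented_rel (generators G) (leavitt_relations G) `` {x}) ` free_algebra (generators G)"
  by (auto simp: leavitt_algebra_def presented_algebra_def Let_def quotient_def)

lemma class_rep_is_representation:
  fixes G :: "('v, 'e) ultragraph"
  assumes G: "ultragraph G" and S: "tail_closed G S"
  shows "is_representation pscale
    (leavitt_algebra G :: ((('v, 'e) generator list \<Rightarrow>\<^sub>0 'r::comm_ring_1) set, 'r) alg)
    (path_module S) (class_rep G S)"
proof -
  let ?F = "free_algebra (generators G) :: (('v, 'e) generator list \<Rightarrow>\<^sub>0 'r) set"
  let ?A = "leavitt_algebra G :: ((('v, 'e) generator list \<Rightarrow>\<^sub>0 'r) set, 'r) alg"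
  let ?M = "path_module S :: (('v, 'e) path \<Rightarrow>\<^sub>0 'r) set"
  let ?P = "path_module (paths G) :: (('v, 'e) path \<Rightarrow>\<^sub>0 'r) set"
  define q where "q = (presented_rel (generators G) (leavitt_relations G)
    :: ((('v, 'e) generator list \<Rightarrow>\<^sub>0 'r) \<times> _) set)"
  define \<rho> where "\<rho> x = restrict (free_act G x) ?M" for x :: "('v, 'e) generator list \<Rightarrow>\<^sub>0 'r"
  have act: "free_act G y \<xi> = free_act G x \<xi>" if "(x, y) \<in> q" "\<xi> \<in> ?P" for x y \<xi>
    using presented_rel_act[OF G] that unfolding q_def by metis
  have q_refl: "(x, x) \<in> q" if "x \<in> ?F" for x
    using that unfolding q_def by (rule presented_rel_refl)
  have SP: "S \<subseteq> paths G" using S by (simp add: tail_closed_def)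
  note F_add = fm.subspace_add[OF free_algebra_subspace[of "generators G"]]
    and F_scale = fm.subspace_scale[OF free_algebra_subspace[of "generators G"]]
    and P_closed = free_act_in_path_module[OF tail_closed_paths]
  have rep: "class_rep G S X = \<rho> x"
    if "x \<in> X" "\<And>y \<xi>. y \<in> X \<Longrightarrow> \<xi> \<in> ?P \<Longrightarrow> free_act G y \<xi> = free_act G x \<xi>" for x X
    unfolding \<rho>_def using SP that by (rule class_rep_eqI)
  have coset: "class_rep G S (q `` {x}) = \<rho> x" if "x \<in> ?F" for x
    unfolding q_def \<rho>_def using G SP that by (rule class_rep_coset)
  have add: "class_rep G S (alg_add ?A (q `` {x}) (q `` {y})) = \<rho> (x + y)"
    if "x \<in> ?F" "y \<in> ?F" for x y
  proof (rule rep)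
    show "x + y \<in> alg_add ?A (q `` {x}) (q `` {y})"
      using that q_refl[OF that(1)] q_refl[OF that(2)] q_refl[OF F_add[OF that]]
      by (auto simp: leavitt_algebra_def presented_algebra_def Let_def q_def[symmetric])
    fix z \<xi> assume "z \<in> alg_add ?A (q `` {x}) (q `` {y})" and \<xi>: "\<xi> \<in> ?P"
    then obtain x' y' where "(x, x') \<in> q" "(y, y') \<in> q" "(x' + y', z) \<in> q"
      by (auto simp: leavitt_algebra_def presented_algebra_def Let_def q_def[symmetric])
    then show "free_act G z \<xi> = free_act G (x + y) \<xi>"
      using \<xi> by (simp add: act free_act_add)
  qed
  have mult: "class_rep G S (alg_mult ?A (q `` {x}) (q `` {y})) = \<rho> (x * y)"
    if "x \<in> ?F" "y \<in> ?F" for x y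
  proof (rule rep)
    show "x * y \<in> alg_mult ?A (q `` {x}) (q `` {y})"
      using that q_refl[OF that(1)] q_refl[OF that(2)] q_refl[OF free_algebra_mult[OF that]]
      by (auto simp: leavitt_algebra_def presented_algebra_def Let_def q_def[symmetric])
    fix z \<xi> assume "z \<in> alg_mult ?A (q `` {x}) (q `` {y})" and \<xi>: "\<xi> \<in> ?P"
    then obtain x' y' where "(x, x') \<in> q" "(y, y') \<in> q" "(x' * y', z) \<in> q"
      by (auto simp: leavitt_algebra_def presented_algebra_def Let_def q_def[symmetric])
    then show "free_act G z \<xi> = free_act G (x * y) \<xi>"
      using \<xi> that by (simp add: act free_act_mult P_closed)
  qed
  have scale: "class_rep G S (alg_scale ?A c (q `` {x})) = \<rho> (pscale c x)"
    if "x \<in> ?F" for c x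
  proof (rule rep)
    show "pscale c x \<in> alg_scale ?A c (q `` {x})"
      using that q_refl[OF that(1)] q_refl[OF F_scale[OF that]]
      by (auto simp: leavitt_algebra_def presented_algebra_def Let_def q_def[symmetric])
    fix z \<xi> assume "z \<in> alg_scale ?A c (q `` {x})" and \<xi>: "\<xi> \<in> ?P"
    then obtain x' where "(x, x') \<in> q" "(pscale c x', z) \<in> q"
      by (auto simp: leavitt_algebra_def presented_algebra_def Let_def q_def[symmetric])
    then show "free_act G z \<xi> = free_act G (pscale c x) \<xi>"
      using \<xi> by (simp add: act free_act_scale)
  qed
  have M: "fm.subspace ?M" unfolding path_module_def by (rule fm.subspace_span)
  have carrier: "alg_carrier ?A = (\<lambda>x. q `` {x}) ` ?F"
    unfolding q_def by (rule leavitt_algebra_carrier)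
  note M_closed = free_act_in_path_module[OF S]
  have "\<rho> x \<in> alg_carrier (End_alg pscale ?M)" if "x \<in> ?F" for x
    using that M_closed[OF that] fm.subspace_add[OF M] fm.subspace_scale[OF M]
    by (auto simp: End_alg_def \<rho>_def free_act_add_right free_act_scale_right)
  moreover have "\<rho> (x + y) = alg_add (End_alg pscale ?M) (\<rho> x) (\<rho> y)" for x y
    by (auto simp: End_alg_def \<rho>_def free_act_add fun_eq_iff)
  moreover have "\<rho> (x * y) = alg_mult (End_alg pscale ?M) (\<rho> x) (\<rho> y)" if "y \<in> ?F" for x y
    using M_closed[OF that]
    by (auto simp: End_alg_def \<rho>_def free_act_mult fun_eq_iff compose_def)
  moreover have "\<rho> (pscale c x) = alg_scale (End_alg pscale ?M) c (\<rho> x)" for c x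
    by (auto simp: End_alg_def \<rho>_def free_act_scale fun_eq_iff)
  ultimately have "alg_hom ?A (End_alg pscale ?M) (class_rep G S)"
    unfolding alg_hom_def carrier by (auto simp: coset add mult scale)
  then show ?thesis using M by (simp add: is_representation_def)
qed

section \<open>Classes of paths\<close>

abbreviation prepend :: "'e list \<Rightarrow> ('v, 'e) path \<Rightarrow> ('v, 'e) path" where
  "prepend a \<delta> \<equiv> foldr path_cons a \<delta>"

lemma prepend_FinPath: "prepend a (FinPath b v) = FinPath (a @ b) v"
  by (induction a) simp_all

lemma prepend_InfPath:
  "prepend a (InfPath x) = InfPath (\<lambda>n. if n < length a then a ! n else x (n - length a))"
  by (induction a) (auto simp: fun_eq_iff split: nat.split)

lemma inj_prepend: "inj (prepend a)"
  by (induction a) (auto simp: inj_def)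

text \<open>One description of equivalence for finite and infinite paths. On paths ending in a sink \<open>v\<close> it is
  the equality of sinks, the common tail being the trivial path at \<open>v\<close>.\<close>

definition common_tail :: "('v, 'e) path \<Rightarrow> ('v, 'e) path \<Rightarrow> bool" where
  "common_tail \<alpha> \<beta> \<longleftrightarrow> (\<exists>a b \<delta>. \<alpha> = prepend a \<delta> \<and> \<beta> = prepend b \<delta>)"

lemma common_tail_FinPath: "common_tail (FinPath a v) \<beta> \<longleftrightarrow> (\<exists>b. \<beta> = FinPath b v)"
proof
  assume "common_tail (FinPath a v) \<beta>"
  then obtain a' b \<delta> where *: "FinPath a v = prepend a' \<delta>" "\<beta> = prepend b \<delta>"
    by (auto simp: common_tail_def)
  then show "\<exists>b. \<beta> = FinPath b v"
    by (cases \<delta>) (auto simp: prepend_FinPath prepend_InfPath)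
next
  assume "\<exists>b. \<beta> = FinPath b v"
  then obtain b where "\<beta> = prepend b (FinPath [] v)" by (auto simp: prepend_FinPath)
  moreover have "FinPath a v = prepend a (FinPath [] v)" by (simp add: prepend_FinPath)
  ultimately show "common_tail (FinPath a v) \<beta>" unfolding common_tail_def by blast
qed

lemma InfPath_eq_prepend: "InfPath x = prepend (map x [0..<i]) (InfPath (\<lambda>k. x (i + k)))"
  by (auto simp: prepend_InfPath fun_eq_iff)

lemma common_tail_InfPath:
  "common_tail (InfPath x) \<beta> \<longleftrightarrow> (\<exists>y. \<beta> = InfPath y \<and> (\<exists>i j. \<forall>k. x (i + k) = y (j + k)))"
proof
  assume "common_tail (InfPath x) \<beta>"
  then obtain a b \<delta> where *: "InfPath x = prepend a \<delta>" "\<beta> = prepend b \<delta>"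
    by (auto simp: common_tail_def)
  then obtain z where z: "\<delta> = InfPath z"
    by (cases \<delta>) (auto simp: prepend_FinPath)
  obtain y where y: "\<beta> = InfPath y"
    using * z by (simp add: prepend_InfPath)
  have "x (length a + k) = y (length b + k)" for k
    using * z y by (simp add: prepend_InfPath)
  then show "\<exists>y. \<beta> = InfPath y \<and> (\<exists>i j. \<forall>k. x (i + k) = y (j + k))"
    using y by blast
next
  assume "\<exists>y. \<beta> = InfPath y \<and> (\<exists>i j. \<forall>k. x (i + k) = y (j + k))"
  then obtain y i j where y: "\<beta> = InfPath y" and k: "\<And>k. x (i + k) = y (j + k)" by blast
  show "common_tail (InfPath x) \<beta>"
    unfolding common_tail_def y
    using InfPath_eq_prepend[of x i] InfPath_eq_prepend[of y j] by (auto simp: k)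
qed

lemma path_equiv_iff:
  "(\<alpha>, \<beta>) \<in> path_equiv G \<longleftrightarrow> \<alpha> \<in> paths G \<and> \<beta> \<in> paths G \<and> common_tail \<alpha> \<beta>"
proof (cases \<alpha>)
  case (FinPath a v)
  then show ?thesis
    by (auto simp: path_equiv_def common_tail_FinPath paths_def inf_paths_def)
next
  case (InfPath x)
  then show ?thesis
    by (auto simp: path_equiv_def common_tail_InfPath paths_def fin_paths_def)
qed

text \<open>If the common tail is the whole of \<open>path_cons e \<beta>\<close>, then \<open>e\<close> moves from the tail into the prefix of
  the other path.\<close>

lemma common_tail_path_cons: "common_tail \<alpha> (path_cons e \<beta>) \<longleftrightarrow> common_tail \<alpha> \<beta>"
proof
  assume "common_tail \<alpha> \<beta>"
  then obtain a b \<delta> where "\<alpha> = prepend a \<delta>" "path_cons e \<beta> = prepend (e # b) \<delta>"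
    by (auto simp: common_tail_def)
  then show "common_tail \<alpha> (path_cons e \<beta>)" unfolding common_tail_def by blast
next
  assume "common_tail \<alpha> (path_cons e \<beta>)"
  then obtain a b \<delta> where *: "\<alpha> = prepend a \<delta>" "path_cons e \<beta> = prepend b \<delta>"
    by (auto simp: common_tail_def)
  show "common_tail \<alpha> \<beta>"
  proof (cases b)
    case Nil
    then have "\<alpha> = prepend (a @ [e]) \<beta>" "\<beta> = prepend [] \<beta>" using * by simp_all
    then show ?thesis unfolding common_tail_def by blast
  next
    case (Cons f b')
    then show ?thesis using * unfolding common_tail_def by auto
  qed
qed

lemma tail_closed_class: "tail_closed G {\<beta> \<in> paths G. common_tail p \<beta>}"
  by (auto simp: tail_closed_def common_tail_path_cons path_cons_in_paths_iff)

text \<open>For infinite paths, the initial piece of one of them up to a position where they differ separates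
  them. Of two distinct finite paths \<open>a\<close> and \<open>b\<close> to the same sink, one is not an initial piece of
  the other, so one of \<open>a\<close> and \<open>b\<close> separates them; if the sinks could differ, this would fail for \<open>a = b\<close>.\<close>

lemma separating_prefix:
  assumes "common_tail p \<alpha>" "common_tail p \<beta>" "\<alpha> \<noteq> \<beta>"
  obtains a where "\<alpha> \<in> range (prepend a) \<longleftrightarrow> \<beta> \<notin> range (prepend a)"
proof (cases p)
  case (FinPath c v)
  then obtain a b where ab: "\<alpha> = FinPath a v" "\<beta> = FinPath b v"
    using assms by (auto simp: common_tail_FinPath)
  have *: "FinPath d v \<in> range (prepend a) \<longleftrightarrow> (\<exists>d'. d = a @ d')" for a d
  proof
    assume "FinPath d v \<in> range (prepend a)"
    then obtain \<delta> where "FinPath d v = prepend a \<delta>" by auto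
    then show "\<exists>d'. d = a @ d'" by (cases \<delta>) (auto simp: prepend_FinPath prepend_InfPath)
  next
    assume "\<exists>d'. d = a @ d'"
    then obtain d' where "FinPath d v = prepend a (FinPath d' v)"
      by (auto simp: prepend_FinPath)
    then show "FinPath d v \<in> range (prepend a)" by blast
  qed
  have "\<not> ((\<exists>d. a = b @ d) \<and> (\<exists>d. b = a @ d))" using assms(3) ab by auto
  then show thesis using that[of a] that[of b] ab * by (metis append_Nil2)
next
  case (InfPath z)
  then obtain x y where xy: "\<alpha> = InfPath x" "\<beta> = InfPath y"
    using assms by (auto simp: common_tail_InfPath)
  then obtain i where i: "x i \<noteq> y i" using assms(3) by auto
  let ?a = "map x [0..<Suc i]"
  have "\<alpha> \<in> range (prepend ?a)"
    using InfPath_eq_prepend[of x "Suc i"] xy by blast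
  moreover have "\<beta> \<notin> range (prepend ?a)"
  proof
    assume "\<beta> \<in> range (prepend ?a)"
    then obtain \<delta> where "\<beta> = prepend ?a \<delta>" by blast
    then have "y i = ?a ! i"
      using xy by (cases \<delta>) (auto simp: prepend_FinPath prepend_InfPath simp del: upt_Suc)
    then show False using i by (simp del: upt_Suc)
  qed
  ultimately show thesis using that by blast
qed

section \<open>Irreducibility\<close>

text \<open>In coordinates, \<open>s\<^sub>e\<^sup>*\<close> is composition with the injective map \<open>path_cons e\<close>. Seen in this way, no
  cancellation can occur between the terms of an element.\<close>

lemma lookup_EdgeStar_act:
  "Poly_Mapping.lookup (lin_ext (gen_act G (EdgeStar e)) \<xi>) \<delta> =
    Poly_Mapping.lookup \<xi> (path_cons e \<delta>)"
proof (induction \<xi> rule: poly_mapping_additive_induct)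
  case (single \<alpha> c)
  show ?case
  proof (cases "path_uncons e \<alpha>")
    case None
    then have "\<alpha> \<noteq> path_cons e \<delta>" by auto
    then show ?thesis using None by (simp add: lookup_single when_def)
  next
    case (Some \<beta>)
    then have "\<alpha> = path_cons e \<beta>" by (simp add: path_uncons_eq_Some_iff)
    then show ?thesis by (simp add: lookup_single when_def)
  qed
qed (simp add: lin_ext_add lookup_add)

lemma lookup_star_word_act:
  "Poly_Mapping.lookup (word_act G (map EdgeStar (rev a)) \<xi>) \<delta> =
    Poly_Mapping.lookup \<xi> (prepend a \<delta>)"
  by (induction a arbitrary: \<xi>) (simp_all add: lookup_EdgeStar_act)

lemma keys_star_word_act:
  "Poly_Mapping.keys (word_act G (map EdgeStar (rev a)) \<xi>) = prepend a -` Poly_Mapping.keys \<xi>"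
  by (auto simp: in_keys_iff lookup_star_word_act)

lemma star_word_act_prepend:
  "word_act G (map EdgeStar (rev a)) (path_basis (prepend a \<delta>)) = path_basis \<delta>"
  by (rule poly_mapping_eqI)
    (auto simp: lookup_star_word_act lookup_single when_def dest: injD[OF inj_prepend])

lemma prepend_in_pathsD: "prepend a \<delta> \<in> paths G \<Longrightarrow> set a \<subseteq> edges G"
  by (induction a) (auto simp: path_cons_in_paths_iff)

text \<open>No factor gives 0 along the way, since each step from \<open>\<delta>\<close> up to \<open>prepend a \<delta>\<close> yields a path.\<close>

lemma edge_word_act_prepend:
  assumes "prepend a \<delta> \<in> paths G"
  shows "word_act G (map Edge a) (path_basis \<delta>) = path_basis (prepend a \<delta>)"
  using assms by (induction a) (auto simp: path_cons_in_paths_iff)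

text \<open>Invariance under the algebra is expressed through the generators acting on the whole free module, so
  that nothing in this context refers to cosets of the free algebra.\<close>

locale invariant_submodule =
  fixes G :: "('v, 'e) ultragraph" and p :: "('v, 'e) path"
    and N :: "(('v, 'e) path \<Rightarrow>\<^sub>0 'r::field) set"
  assumes p: "p \<in> paths G"
    and subspace: "fm.subspace N"
    and in_class: "\<xi> \<in> N \<Longrightarrow> Poly_Mapping.keys \<xi> \<subseteq> {\<beta> \<in> paths G. common_tail p \<beta>}"
    and invariant: "g \<in> generators G \<Longrightarrow> \<xi> \<in> N \<Longrightarrow> lin_ext (gen_act G g) \<xi> \<in> N"
begin

lemma word_act_in: "set w \<subseteq> generators G \<Longrightarrow> \<xi> \<in> N \<Longrightarrow> word_act G w \<xi> \<in> N"
  by (induction w) (auto intro: invariant)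

lemma star_word_act_in:
  "set a \<subseteq> edges G \<Longrightarrow> \<xi> \<in> N \<Longrightarrow> word_act G (map EdgeStar (rev a)) \<xi> \<in> N"
  by (rule word_act_in) (auto simp: generators_def)

text \<open>Stripping a prefix shared by some but not all paths of the support loses at least one of them and
  keeps at least one.\<close>

lemma smaller_support:
  assumes \<xi>: "\<xi> \<in> N" and keys: "\<alpha> \<in> Poly_Mapping.keys \<xi>" "\<beta> \<in> Poly_Mapping.keys \<xi>" "\<alpha> \<noteq> \<beta>"
  shows "\<exists>\<eta>\<in>N. \<eta> \<noteq> 0 \<and> card (Poly_Mapping.keys \<eta>) < card (Poly_Mapping.keys \<xi>)"
proof -
  obtain a where a: "\<alpha> \<in> range (prepend a) \<longleftrightarrow> \<beta> \<notin> range (prepend a)"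
    using separating_prefix[of p \<alpha> \<beta>] in_class[OF \<xi>] keys by blast
  let ?\<eta> = "word_act G (map EdgeStar (rev a)) \<xi>"
  let ?K = "Poly_Mapping.keys \<xi>"
  have ne: "?K \<inter> range (prepend a) \<noteq> {}" and less: "?K \<inter> range (prepend a) \<subset> ?K"
    using a keys by blast+
  then obtain \<delta> where \<delta>: "prepend a \<delta> \<in> ?K" by blast
  then have "set a \<subseteq> edges G"
    using in_class[OF \<xi>] prepend_in_pathsD by blast
  then have "?\<eta> \<in> N" using \<xi> by (rule star_word_act_in)
  moreover have "?\<eta> \<noteq> 0"
    using \<delta> keys_star_word_act[of G a \<xi>] by auto
  moreover have "card (Poly_Mapping.keys ?\<eta>) = card (?K \<inter> range (prepend a))"
    unfolding keys_star_word_act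
    by (metis card_vimage_inj_on_le card_image image_vimage_eq inj_on_subset inj_prepend subset_UNIV)
  ultimately show ?thesis
    using psubset_card_mono[OF finite_keys less] by metis
qed

lemma contains_basis_element:
  assumes "N \<noteq> {0}"
  obtains \<alpha> where "path_basis \<alpha> \<in> N"
proof -
  have "\<exists>\<xi>. \<xi> \<in> N \<and> \<xi> \<noteq> 0" using assms fm.subspace_0[OF subspace] by blast
  then obtain \<xi> where \<xi>: "\<xi> \<in> N" "\<xi> \<noteq> 0"
    and min: "\<And>\<eta>. \<eta> \<in> N \<Longrightarrow> \<eta> \<noteq> 0 \<Longrightarrow> card (Poly_Mapping.keys \<xi>) \<le> card (Poly_Mapping.keys \<eta>)"
    using ex_has_least_nat[of "\<lambda>\<xi>. \<xi> \<in> N \<and> \<xi> \<noteq> 0" _ "\<lambda>\<xi>. card (Poly_Mapping.keys \<xi>)"] by blast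
  obtain \<alpha> where \<alpha>: "\<alpha> \<in> Poly_Mapping.keys \<xi>" using \<xi>(2) keys_eq_empty by blast
  have "Poly_Mapping.keys \<xi> = {\<alpha>}"
    using smaller_support[OF \<xi>(1) \<alpha>] min \<alpha> leD by blast
  \<comment> \<open>the only place where the scalars need to form a field\<close>
  then have "pscale (inverse (Poly_Mapping.lookup \<xi> \<alpha>)) \<xi> = path_basis \<alpha>"
    by (intro poly_mapping_eqI) (auto simp: lookup_single when_def in_keys_iff set_eq_iff)
  then show thesis using that fm.subspace_scale[OF subspace \<xi>(1)] by metis
qed

text \<open>Strip \<open>\<alpha>\<close> down to the common tail, then build up \<open>\<beta>\<close> from it.\<close>

lemma move_along_common_tail:
  assumes "path_basis \<alpha> \<in> N" "common_tail \<alpha> \<beta>" "\<alpha> \<in> paths G" "\<beta> \<in> paths G"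
  shows "path_basis \<beta> \<in> N"
proof -
  obtain a b \<delta> where ab: "\<alpha> = prepend a \<delta>" "\<beta> = prepend b \<delta>"
    using assms(2) by (auto simp: common_tail_def)
  have "path_basis \<delta> \<in> N"
    using star_word_act_in[OF prepend_in_pathsD assms(1), of a \<delta>] assms(3)
    by (simp only: ab star_word_act_prepend)
  then have "word_act G (map Edge b) (path_basis \<delta>) \<in> N"
    using prepend_in_pathsD[of b \<delta> G] assms(4) ab
    by (intro word_act_in) (auto simp: generators_def)
  then show ?thesis using assms(4) by (simp only: ab edge_word_act_prepend)
qed

text \<open>Every member of the class shares a tail with the representative \<open>p\<close>, so all of them are reached
  from the given one by passing through \<open>p\<close>.\<close>

lemma class_module_subset:
  assumes "N \<noteq> {0}"
  shows "path_module {\<beta> \<in> paths G. common_tail p \<beta>} \<subseteq> N"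
proof -
  obtain \<alpha> where \<alpha>: "path_basis \<alpha> \<in> N" by (rule contains_basis_element[OF assms])
  then have "\<alpha> \<in> paths G" "common_tail p \<alpha>" using in_class[OF \<alpha>] by auto
  moreover from this have "common_tail \<alpha> p" by (auto simp: common_tail_def)
  ultimately have "path_basis p \<in> N" using move_along_common_tail[OF \<alpha>] p by blast
  then have "path_basis ` {\<beta> \<in> paths G. common_tail p \<beta>} \<subseteq> N"
    using move_along_common_tail p by blast
  then show ?thesis
    unfolding path_module_def using subspace by (rule fm.span_minimal)
qed

end

theorem proposition3p9:
  fixes G :: "('v, 'e) ultragraph"
    and c :: "('v, 'e) path set"
  assumes "ultragraph G"
    and "c \<in> paths G // path_equiv G"
  shows "irreducible_representation pscale
    (leavitt_algebra G :: ((('v, 'e) generator list \<Rightarrow>\<^sub>0 'r::field) set, 'r) alg)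
    (path_module c) (class_rep G c)"
proof -
  let ?A = "leavitt_algebra G :: ((('v, 'e) generator list \<Rightarrow>\<^sub>0 'r) set, 'r) alg"
  let ?M = "path_module c :: (('v, 'e) path \<Rightarrow>\<^sub>0 'r) set"
  obtain p where p: "p \<in> paths G" and "c = path_equiv G `` {p}"
    using assms(2) by (rule quotientE)
  then have c: "c = {\<beta> \<in> paths G. common_tail p \<beta>}"
    by (auto simp: path_equiv_iff)
  have closed: "tail_closed G c" unfolding c by (rule tail_closed_class)
  have "p = prepend [] p" by simp
  then have "common_tail p p" unfolding common_tail_def by blast
  then have "path_basis p \<in> ?M" using p by (simp add: path_module_eq c)
  moreover have "path_basis p \<noteq> (0 :: ('v, 'e) path \<Rightarrow>\<^sub>0 'r)"
    by (metis keys_single keys_zero insert_not_empty zero_neq_one)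
  ultimately have "?M \<noteq> {0}" by blast
  moreover have "N = {0} \<or> N = ?M"
    if N: "fm.subspace N" "N \<subseteq> ?M" "\<And>X. X \<in> alg_carrier ?A \<Longrightarrow> class_rep G c X ` N \<subseteq> N" for N
  proof -
    have "lin_ext (gen_act G g) \<xi> \<in> N" if g: "g \<in> generators G" and \<xi>: "\<xi> \<in> N" for g \<xi>
    proof -
      let ?X = "presented_rel (generators G) (leavitt_relations G) `` {gen g}
        :: (('v, 'e) generator list \<Rightarrow>\<^sub>0 'r) set"
      have "?X \<in> alg_carrier ?A"
        unfolding leavitt_algebra_carrier using gen_in_free_algebra[OF g] by blast
      then have "class_rep G c ?X \<xi> \<in> N" using N(3) \<xi> by blast
      moreover have "class_rep G c ?X = restrict (free_act G (gen g)) ?M"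
        using closed by (intro class_rep_coset assms(1) gen_in_free_algebra[OF g])
          (simp add: tail_closed_def)
      ultimately show ?thesis using \<xi> N(2) by auto
    qed
    then interpret invariant_submodule G p N
      using p N(1,2) by unfold_locales (auto simp: path_module_eq c)
    show ?thesis using class_module_subset N(2) c by blast
  qed
  ultimately show ?thesis
    using class_rep_is_representation[OF assms(1) closed]
    by (auto simp: irreducible_representation_def)
qed

end
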